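(* Let $y$ be an odd positive integer. (i) If $y$ is not a Zumkeller number, then $\mathrm{Ulam}[y]=\mathrm{Ulam}[y-1]$. (ii) If $y$ is a Zumkeller number, then $\mathrm{Ulam}[y]$ and $\mathrm{Ulam}[y-1]$ coincide outside of impurities: for every $(x,z)\in\mathbb{N}^2$ that is an impurity neither of $\mathrm{Ulam}[y]$ nor of $\mathrm{Ulam}[y-1]$, we have $(x,z)\in\mathrm{Ulam}[y]\iff(x,z)\in\mathrm{Ulam}[y-1]$.
   Context: $\mathbb{N}=\{0,1,2,\dots\}$. Ulam words are binary words defined recursively: $\mathcal{U}(1)=\{0,1\}$, and for $n>1$, $\mathcal{U}(n)$ is the set of all words of length $n$ over $\{0,1\}$ that are expressible uniquely as a concatenation $uv$ of two distinct words $u\in\mathcal{U}(i)$, $v\in\mathcal{U}(j)$ with $i,j<n$ (i.e. there is exactly one ordered pair $(u,v)$ of such words, $u\ne v$). A word is Ulam if it belongs to $\bigcup_{n\ge1}\mathcal{U}(n)$. $0^m$ denotes a block of $m$ zeros. $\mathrm{Ulam}[y]\subset\mathbb{N}^2$ is the set of $(x,z)$ such that the word $0^x10^y10^z$ is Ulam. A positive integer is a Zumkeller number if it has at most one $0$ in its binary representation. Impurities: for a Zumkeller number $y$ with $2^k\le y<2^{k+1}$, there is a unique set $P_y\subset\mathbb{N}^2$ that is biperiodic with biperiod $2^{k+1}\times2^{k+1}$ (meaning $(x,z)\in P_y\iff(x+2^{k+1},z)\in P_y\iff(x,z+2^{k+1})\in P_y$ for all $x,z\in\mathbb{N}$) and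 that agrees with $\mathrm{Ulam}[y]$ at all points outside the block $\{(x,z):x,z<2^{k+1}\}$. The impurities of $\mathrm{Ulam}[y]$ are the points lying in exactly one of $\mathrm{Ulam}[y]$ and $P_y$. If $y\ge0$ is not a Zumkeller number, $\mathrm{Ulam}[y]$ has no impurities. *)

theory Defs
  imports Main "HOL-Library.Discrete_Functions"
begin

text \<open>Binary words are lists of Booleans, where \<open>False\<close> is the letter 0 and \<open>True\<close> the letter 1.\<close>

text \<open>The set of Ulam words of length \<open>n\<close>; there are none of length \<open>0\<close>.\<close>

fun ulam_words :: "nat \<Rightarrow> bool list set" where
  "ulam_words n =
    (if n = 0 then {}
     else if n = 1 then {[False], [True]}
     else {w. length w = n \<and>
            (\<exists>!(u, v). w = u @ v \<and> u \<noteq> v \<and>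
               (\<exists>i\<in>{1..<n}. \<exists>j\<in>{1..<n}. u \<in> ulam_words i \<and> v \<in> ulam_words j))})"

declare ulam_words.simps [simp del]

definition is_ulam :: "bool list \<Rightarrow> bool" where
  "is_ulam w \<longleftrightarrow> w \<in> (\<Union>n\<in>{1..}. ulam_words n)"

definition two_ones_word :: "nat \<Rightarrow> nat \<Rightarrow> nat \<Rightarrow> bool list" where
  "two_ones_word x y z =
     replicate x False @ [True] @ replicate y False @ [True] @ replicate z False"

definition Ulam_set :: "nat \<Rightarrow> (nat \<times> nat) set" where
  "Ulam_set y = {(x, z). is_ulam (two_ones_word x y z)}"

text \<open>For \<open>y > 0\<close>, \<open>floor_log y\<close> is the \<open>k\<close> with \<open>2 ^ k \<le> y < 2 ^ (k + 1)\<close>, so the binary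
  representation of \<open>y\<close> consists of the bits \<open>0, \<dots>, floor_log y\<close>.\<close>

definition zumkeller :: "nat \<Rightarrow> bool" where
  "zumkeller y \<longleftrightarrow> y > 0 \<and> card {i. i \<le> floor_log y \<and> \<not> bit y i} \<le> 1"

definition biperiodic :: "nat \<Rightarrow> (nat \<times> nat) set \<Rightarrow> bool" where
  "biperiodic q P \<longleftrightarrow>
     (\<forall>x z. ((x, z) \<in> P \<longleftrightarrow> (x + q, z) \<in> P) \<and> ((x, z) \<in> P \<longleftrightarrow> (x, z + q) \<in> P))"

text \<open>The biperiodic part of \<open>Ulam_set y\<close>; only meaningful when \<open>y\<close> is a Zumkeller number.\<close>

definition periodic_part :: "nat \<Rightarrow> (nat \<times> nat) set" where
  "periodic_part y = (let q = 2 ^ (floor_log y + 1) in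
     THE P. biperiodic q P \<and>
       (\<forall>x z. \<not> (x < q \<and> z < q) \<longrightarrow> ((x, z) \<in> P \<longleftrightarrow> (x, z) \<in> Ulam_set y)))"

definition impurities :: "nat \<Rightarrow> (nat \<times> nat) set" where
  "impurities y =
     (if zumkeller y
      then (Ulam_set y - periodic_part y) \<union> (periodic_part y - Ulam_set y)
      else {})"

end

theory Submission
  imports Defs
begin

text \<open>
  Cutting \<open>0\<^sup>x 1 0\<^sup>y 1 0\<^sup>z\<close> into two Ulam words either removes an outer \<open>0\<close> or separates the two ones,
  and \<open>0\<^sup>a 1 0\<^sup>b\<close> is Ulam iff \<open>a\<close> and \<open>b\<close> have no common binary digit. So membership of \<open>(x, z)\<close> in
  \<open>Ulam[y]\<close> is decided by its left and lower neighbours together with \<open>c(x, y, z)\<close>, the number of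
  \<open>i \<le> y\<close> such that \<open>x\<close> is disjoint from \<open>i\<close> and \<open>z\<close> from \<open>y - i\<close>; the cut with two equal halves,
  possible iff \<open>x + z = y\<close> with \<open>x\<close>, \<open>z\<close> disjoint, does not count. If that correction is ignored, the
  recursion (for \<open>y > 0\<close>) has the explicit solution
  ``\<open>x + z\<close> is odd and \<open>c(x div 2, y div 2, z div 2) = 1\<close>'', which is biperiodic and depends only on
  \<open>y div 2\<close>. When \<open>y\<close> has at least two zero digits, \<open>c \<ge> 3\<close> wherever the correction applies, so it has no
  effect; otherwise it only changes the block of impurities, and the solution above is the
  biperiodic part.
\<close>

subsection \<open>Counting disjoint splittings\<close>

definition splits :: "nat \<Rightarrow> nat \<Rightarrow> nat \<Rightarrow> nat" where
  "splits x n z = (\<Sum>i\<le>n. of_bool (and x i = 0 \<and> and z (n - i) = 0))"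

lemma and_eq_0_double: "and x (2 * i) = 0 \<longleftrightarrow> and (x div 2) i = (0::nat)"
  by (simp add: and_rec[of x "2*i"])

lemma and_eq_0_double_Suc: "and x (Suc (2 * i)) = 0 \<longleftrightarrow> even x \<and> and (x div 2) i = (0::nat)"
  by (auto simp add: and_rec[of x "Suc (2*i)"])

lemma sum_atMost_odd: "(\<Sum>i\<le>Suc (2 * m). g i) = (\<Sum>i\<le>m. g (2 * i)) + (\<Sum>i\<le>m. g (Suc (2 * i)) :: nat)"
  by (induction m) auto

lemma sum_atMost_even: "(\<Sum>i\<le>2 * Suc m. g i) = (\<Sum>i\<le>Suc m. g (2 * i)) + (\<Sum>i\<le>m. g (Suc (2 * i)) :: nat)"
  by (induction m) (auto simp: numeral_2_eq_2)

text \<open>One of the two summands is odd, and it only forces its partner x or z to be even. Both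
  choices leave the same halved problem.\<close>

lemma splits_odd:
  "splits x (Suc (2 * m)) z =
     (of_bool (even x) + of_bool (even z)) * splits (x div 2) m (z div 2)"
proof -
  have a: "Suc (2 * m) - 2 * i = Suc (2 * (m - i))" if "i \<le> m" for i using that by simp
  have b: "Suc (2 * m) - Suc (2 * i) = 2 * (m - i)" for i by simp
  show ?thesis unfolding splits_def sum_atMost_odd b
    by (auto simp: a and_eq_0_double and_eq_0_double_Suc simp del: diff_Suc_Suc diff_mult_distrib2)
qed

text \<open>Two even summands halve to a splitting of \<open>Suc m\<close>. Two odd ones need x and
  z even and lose a carry in halving, hence m.\<close>

lemma splits_even:
  "splits x (Suc (Suc (2 * m))) z =
     splits (x div 2) (Suc m) (z div 2) + of_bool (even x \<and> even z) * splits (x div 2) m (z div 2)"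
proof -
  have a: "2 * Suc m - 2 * i = 2 * (Suc m - i)" for i by simp
  have b: "2 * Suc m - Suc (2 * i) = Suc (2 * (m - i))" if "i \<le> m" for i using that by simp
  have "splits x (2 * Suc m) z =
     splits (x div 2) (Suc m) (z div 2) + of_bool (even x \<and> even z) * splits (x div 2) m (z div 2)"
    unfolding splits_def sum_atMost_even a
    by (auto simp: b and_eq_0_double and_eq_0_double_Suc simp del: diff_Suc_Suc diff_mult_distrib2 mult_Suc_right)
  then show ?thesis by simp
qed

lemma splits_0 [simp]: "splits x 0 z = 1"
  by (simp add: splits_def)

lemma splits_commute: "splits x n z = splits z n x"
  unfolding splits_def
  by (rule sum.reindex_bij_witness[of _ "\<lambda>i. n - i" "\<lambda>i. n - i"]) auto

lemma splits_pos_left: "splits 0 n z > 0"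
proof -
  have "(1::nat) = of_bool (and 0 n = (0::nat) \<and> and z (n - n) = 0)" by simp
  also have "\<dots> \<le> splits 0 n z" unfolding splits_def by (rule member_le_sum) auto
  finally show ?thesis by simp
qed

lemma splits_pos_right: "splits x n 0 > 0"
  using splits_pos_left splits_commute by metis

lemma nat_binary_cases:
  obtains (zero) "n = 0" | (odd) m where "n = Suc (2 * m)" | (even) m where "n = Suc (Suc (2 * m))"
proof (cases "even n")
  case True then obtain k where "n = 2 * k" by auto
  then show ?thesis using zero even by (cases k) auto
next
  case False then show ?thesis using odd by (metis oddE Suc_eq_plus1)
qed

text \<open>Halving: an odd x keeps \<open>x div 2\<close> when lowered, and then both counts
  coincide. For even x the half drops by one, and either the induction hypothesis applies or both
  sides fail.\<close>

lemma splits_neighbour: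
  assumes "splits x (Suc n) z = 0"
  shows "splits x n z = 1 \<longleftrightarrow> splits (x - 1) (Suc n) z = 1"
  using assms
proof (induction n arbitrary: x z rule: less_induct)
  case (less n)
  \<comment> \<open>Counts on the axes are positive, so the truncated \<open>x - 1\<close> is a
    genuine predecessor.\<close>
  then have "x \<noteq> 0" "z \<noteq> 0" using splits_pos_left splits_pos_right by (metis less_numeral_extra(3))+
  consider (odd) m where "Suc n = Suc (2 * m)" | (even) m where "Suc n = Suc (Suc (2 * m))"
    using nat_binary_cases[of "Suc n"] by blast
  then show ?case
  proof cases
    case odd
    show ?thesis
    proof (cases m)
      case 0
      with less.prems odd show ?thesis using splits_odd[of x 0 z] splits_odd[of "x-1" 0 z] \<open>x \<noteq> 0\<close> by auto
    next
      case (Suc k)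
      have n: "n = Suc (Suc (2 * k))" using odd Suc by simp
      have IH: "splits (x div 2) (Suc k) (z div 2) = 0 \<Longrightarrow> splits (x div 2) k (z div 2) = 1
            \<longleftrightarrow> splits (x div 2 - 1) (Suc k) (z div 2) = 1"
        using less.IH[of k] n by simp
      have "x div 2 - 1 = (x - 1) div 2" if "even x" using that by auto
      moreover have "(x - 1) div 2 = x div 2" if "odd x" using that by (auto elim: oddE)
      ultimately show ?thesis using less.prems IH \<open>x \<noteq> 0\<close> unfolding odd Suc n
        by (auto simp: splits_odd splits_odd[of _ "Suc k", simplified] splits_even)
    qed
  next
    case even
    then have n: "n = Suc (2 * m)" by simp
    have IH: "splits (x div 2) (Suc m) (z div 2) = 0 \<Longrightarrow> splits (x div 2) m (z div 2) = 1
            \<longleftrightarrow> splits (x div 2 - 1) (Suc m) (z div 2) = 1"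
        using less.IH[of m] n by simp
    have "x div 2 - 1 = (x - 1) div 2" if "even x" using that by auto
    moreover have "(x - 1) div 2 = x div 2" if "odd x" using that by (auto elim: oddE)
    ultimately show ?thesis using less.prems IH \<open>x \<noteq> 0\<close> unfolding even n
        by (auto simp: splits_odd splits_even)
  qed
qed

text \<open>By symmetry both sides are equivalent to \<open>splits x m z = 1\<close> for the
  predecessor m of n. For n = 0 the count is 1, against the assumption.\<close>

lemma splits_neighbours_agree:
  assumes "splits x n z = 0"
  shows "splits (x - 1) n z = 1 \<longleftrightarrow> splits x n (z - 1) = 1"
proof (cases n)
  case (Suc m)
  then show ?thesis using splits_neighbour[of x m z] splits_neighbour[of z m x] assms
    by (simp add: splits_commute)
qed (use assms in simp)

text \<open>For odd \<open>Suc n\<close> the hypotheses clash: the halved count would be 1, yet it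
  is a summand of \<open>splits x n z\<close>. For even \<open>Suc n\<close> an odd coordinate can
  be lowered without changing the halves; two even ones need the induction hypothesis.\<close>

lemma splits_eq_1_neighbour:
  assumes "splits x (Suc n) z = 1" "splits x n z = 0"
  shows "splits (x - 1) (Suc n) z = 1 \<or> splits x (Suc n) (z - 1) = 1"
  using assms
proof (induction n arbitrary: x z rule: less_induct)
  case (less n)
  have xz: "x \<noteq> 0" "z \<noteq> 0" using splits_pos_left splits_pos_right less.prems by (metis less_numeral_extra(3))+
  consider (odd) m where "Suc n = Suc (2 * m)" | (even) m where "Suc n = Suc (Suc (2 * m))"
    using nat_binary_cases[of "Suc n"] by blast
  then show ?case
  proof cases
    case odd
    then have n: "n = 2 * m" by simp
    show ?thesis
    proof (cases m)
      case 0
      with less.prems odd show ?thesis by simp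
    next
      case (Suc k)
      then show ?thesis using less.prems unfolding odd n Suc
        by (auto simp: splits_odd splits_odd[of _ "Suc k", simplified] splits_even split: if_splits)
    qed
  next
    case even
    then have n: "n = Suc (2 * m)" by simp
    have IH: "splits (x div 2) (Suc m) (z div 2) = 1 \<Longrightarrow> splits (x div 2) m (z div 2) = 0
       \<Longrightarrow> splits (x div 2 - 1) (Suc m) (z div 2) = 1 \<or> splits (x div 2) (Suc m) (z div 2 - 1) = 1"
      using less.IH[of m] n by simp
    have *: "u div 2 - 1 = (u - 1) div 2" if "even u" for u :: nat using that by auto
    moreover have **: "(u - 1) div 2 = u div 2" if "odd u" for u :: nat using that by (auto elim: oddE)
    ultimately show ?thesis using less.prems IH xz unfolding even n
      by (cases "even x"; cases "even z") (auto simp: * ** splits_odd splits_even)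
  qed
qed

subsection \<open>The recursion without the equal-halves correction\<close>

definition bulk :: "nat \<Rightarrow> nat \<Rightarrow> nat \<Rightarrow> bool" where
  "bulk y x z \<longleftrightarrow> odd (x + z) \<and> splits (x div 2) (y div 2) (z div 2) = 1"

text \<open>The guards matter: since \<open>0 - 1 = 0\<close>, a cell on an axis would otherwise
  count itself.\<close>

definition before :: "(nat \<Rightarrow> nat \<Rightarrow> bool) \<Rightarrow> nat \<Rightarrow> nat \<Rightarrow> nat" where
  "before u x z = of_bool (x > 0 \<and> u (x - 1) z) + of_bool (z > 0 \<and> u x (z - 1))"

lemma splits_even_if_odd:
  assumes "odd n" "even (x + z)"
  shows "even (splits x n z)"
  using assms by (auto elim!: oddE simp: splits_odd)

lemma div_2_minus_1: "0 < (x::nat) \<Longrightarrow> even x \<Longrightarrow> (x - 1) div 2 = x div 2 - 1" "odd x \<Longrightarrow> (x - 1) div 2 = x div 2"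
  by (auto elim!: oddE evenE)

text \<open>
  The delicate cells are those with both coordinates even, which must stay empty: there
  \<open>splits_neighbours_agree\<close> (count 0) and \<open>splits_eq_1_neighbour\<close> (count 1) control the two neighbours.
\<close>

lemma bulk_step:
  assumes "y > 0"
  shows "bulk y x z \<longleftrightarrow> before (bulk y) x z + splits x y z = 1"
proof (cases "odd (x + z)")
  \<comment> \<open>Neighbours have even coordinate sum, so none is present, and opposite parities
    make the count equal to the halved one.\<close>
  case True
  then have 1: "before (bulk y) x z = 0"
    by (auto simp: before_def bulk_def)
  show ?thesis
  proof (cases y rule: nat_binary_cases)
    case zero with assms show ?thesis by simp
  next
    case (odd m) with True 1 show ?thesis
      by (auto simp: bulk_def splits_odd)
  next
    case (even m) with True 1 show ?thesis
      by (auto simp: bulk_def splits_even)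
  qed
next
  case par: False
  consider (oo) "odd x" "odd z" | (ee) "even x" "even z" using par by auto
  then show ?thesis
  proof cases
    \<comment> \<open>Both neighbours have the same halves as (x, z). If the halved count is 1, both
      are present and the total exceeds 1; otherwise none is, and the count is not 1 either.\<close>
    case oo
    then obtain a c where "x = 2 * a + 1" "z = 2 * c + 1" by (metis oddE)
    then have b: "before (bulk y) x z = 2 * of_bool (splits (x div 2) (y div 2) (z div 2) = 1)"
      by (simp add: before_def bulk_def)
    have s: "splits x y z = 0 \<or> splits x y z = splits (x div 2) (y div 2) (z div 2)"
      using oo assms
      by (cases y rule: nat_binary_cases) (auto simp: splits_odd splits_even)
    have "\<not> bulk y x z" using par by (simp add: bulk_def)
    then show ?thesis using b s by auto
  next
    case ee
    let ?f = "splits (x div 2) (y div 2) (z div 2)"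
    let ?A = "splits (x div 2 - 1) (y div 2) (z div 2) = 1"
    let ?B = "splits (x div 2) (y div 2) (z div 2 - 1) = 1"
    have b: "before (bulk y) x z = of_bool (x > 0 \<and> ?A) + of_bool (z > 0 \<and> ?B)"
    proof -
      have "bulk y (x - 1) z \<longleftrightarrow> ?A" if "x > 0"
        using that ee div_2_minus_1(1)[of x] by (simp add: bulk_def)
      moreover have "bulk y x (z - 1) \<longleftrightarrow> ?B" if "z > 0"
        using that ee div_2_minus_1(1)[of z] by (simp add: bulk_def)
      ultimately show ?thesis by (simp add: before_def cong: conj_cong)
    qed
    have pos: "x > 0 \<and> z > 0" if "splits (x div 2) n (z div 2) = 0" for n
      using that splits_pos_left[of n "z div 2"] splits_pos_right[of "x div 2" n]
      by (auto intro!: gr0I)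
    have 0: "?f = 0 \<Longrightarrow> x > 0 \<and> z > 0 \<and> ?A = ?B"
      using pos splits_neighbours_agree by blast
    have nb: "\<not> bulk y x z" using par by (simp add: bulk_def)
    show ?thesis
    proof (cases y rule: nat_binary_cases)
      case zero with assms show ?thesis by simp
    next
      case (odd m)
      then have "splits x y z = 2 * ?f" using ee by (simp add: splits_odd)
      then show ?thesis using b 0 nb by (cases "?f = 0") auto
    next
      case (even m)
      then have y2: "y div 2 = Suc m" by simp
      have s: "splits x y z = ?f + splits (x div 2) m (z div 2)"
        unfolding y2 unfolding even using ee by (simp add: splits_even)
      have ne: "x > 0 \<and> z > 0" if "?f + splits (x div 2) m (z div 2) = 1"
      proof -
        have "?f = 0 \<or> splits (x div 2) m (z div 2) = 0" using that by auto
        then show ?thesis using pos by blast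
      qed
      have AB: "?A \<or> ?B" if "?f + splits (x div 2) m (z div 2) = 1"
        using that splits_neighbour[of "x div 2" m "z div 2"] splits_eq_1_neighbour[of "x div 2" m "z div 2"]
        unfolding y2 by (auto simp: add_is_1)
      consider "splits x y z = 0" | "splits x y z = 1" | "splits x y z \<ge> 2" by linarith
      then show ?thesis
      proof cases
        case 1
        then have "x > 0 \<and> z > 0 \<and> ?A = ?B" using s 0 by simp
        then show ?thesis using b nb 1 by (cases ?A) auto
      next
        case 2
        then have "x > 0 \<and> z > 0" "?A \<or> ?B" using s ne AB by presburger+
        then show ?thesis using b nb 2 by (cases ?A) auto
      next
        case 3
        then show ?thesis using nb by simp
      qed
    qed
  qed
qed

text \<open>Numbers up to \<open>y div 2\<close> only use digits below position r - 1, while adding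
  \<open>2 ^ r\<close> to x changes \<open>x div 2\<close> only from that position on.\<close>

lemma bulk_add_period:
  assumes "y < 2 ^ r" "r > 0"
  shows "bulk y (x + 2 ^ r) z \<longleftrightarrow> bulk y x z" "bulk y x (z + 2 ^ r) \<longleftrightarrow> bulk y x z"
proof -
  have "bulk y (x + 2 ^ r) z \<longleftrightarrow> bulk y x z" for x z
  proof -
    obtain k where Suc: "r = Suc k" using assms(2) by (cases r) auto
    have "and (x div 2 + 2 ^ k) i = and (x div 2) i" if "i \<le> y div 2" for i
    proof -
      have "i < 2 ^ k" using that assms Suc by auto
      then have i: "take_bit k i = i" by (simp add: take_bit_nat_eq_self)
      have "and u i = and (take_bit k u) i" for u
        using i by (metis and.assoc and.commute take_bit_eq_mask)
      moreover have "take_bit k (x div 2 + 2 ^ k) = take_bit k (x div 2)"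
        by (simp add: take_bit_eq_mod)
      ultimately show ?thesis by metis
    qed
    then have "splits (2 ^ k + x div 2) (y div 2) (z div 2) = splits (x div 2) (y div 2) (z div 2)"
      unfolding splits_def by (intro sum.cong) (auto simp: add.commute)
    then show ?thesis using Suc by (simp add: bulk_def)
  qed
  moreover have "bulk y x z = bulk y z x" for x z
    by (simp add: bulk_def splits_commute add.commute)
  ultimately show "bulk y (x + 2 ^ r) z \<longleftrightarrow> bulk y x z" "bulk y x (z + 2 ^ r) \<longleftrightarrow> bulk y x z"
    by blast+
qed

subsection \<open>Ulam words with at most two ones\<close>

definition good_cut :: "bool list \<Rightarrow> nat \<Rightarrow> bool" where
  "good_cut w p \<longleftrightarrow> take p w \<noteq> drop p w \<and> is_ulam (take p w) \<and> is_ulam (drop p w)"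

lemma ulam_words_0 [simp]: "ulam_words 0 = {}"
  using ulam_words.simps[of 0] by (simp only: if_True simp_thms)
lemma ulam_words_1: "ulam_words 1 = {[False], [True]}"
  using ulam_words.simps[of 1] by (simp only: if_True if_False one_neq_zero simp_thms)

lemma ulam_words_rec:
  assumes "n > 1"
  shows "ulam_words n = {w. length w = n \<and> (\<exists>!(u, v). w = u @ v \<and> u \<noteq> v \<and>
               (\<exists>i\<in>{1..<n}. \<exists>j\<in>{1..<n}. u \<in> ulam_words i \<and> v \<in> ulam_words j))}"
proof -
  have "n \<noteq> 0" "n \<noteq> 1" using assms by auto
  then show ?thesis by (subst ulam_words.simps) (simp only: if_False)
qed

lemma ulam_words_length:
  assumes w: "w \<in> ulam_words n" shows "length w = n"
proof -
  consider "n = 0" | "n = 1" | "n > 1" by linarith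
  then show ?thesis
  proof cases
    case 1 with w show ?thesis by simp
  next
    case 2 with w show ?thesis unfolding 2 ulam_words_1 by auto
  next
    case 3
    with w show ?thesis unfolding ulam_words_rec[OF 3] by blast
  qed
qed

lemma is_ulam_iff_length: "is_ulam w \<longleftrightarrow> w \<in> ulam_words (length w)"
proof
  assume "is_ulam w"
  then obtain n where n: "w \<in> ulam_words n" by (auto simp: is_ulam_def)
  with ulam_words_length[OF n] show "w \<in> ulam_words (length w)" by simp
next
  assume w: "w \<in> ulam_words (length w)"
  then have "length w \<noteq> 0" by (metis empty_iff ulam_words_0)
  then have "length w \<in> {1..}" by (simp add: Suc_leI)
  with w show "is_ulam w" unfolding is_ulam_def by blast
qed

lemma not_is_ulam_Nil [simp]: "\<not> is_ulam []"
  by (simp add: is_ulam_iff_length)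

lemma is_ulam_singleton [simp]: "is_ulam [b]"
proof -
  have "[b] \<in> {[False], [True]}" by (cases b) simp_all
  then have "[b] \<in> ulam_words 1" unfolding ulam_words_1 .
  then show ?thesis by (simp add: is_ulam_iff_length)
qed

lemma card_eq_1_iff_Ex1: "card A = 1 \<longleftrightarrow> (\<exists>!x. x \<in> A)"
proof
  assume "card A = 1"
  then obtain x where "A = {x}" by (rule card_1_singletonE)
  then show "\<exists>!x. x \<in> A" by simp
next
  assume "\<exists>!x. x \<in> A"
  then obtain x where "x \<in> A" "\<forall>y. y \<in> A \<longrightarrow> y = x" by (rule ex1E)
  then have "A = {x}" by blast
  then show "card A = 1" by simp
qed

text \<open>Factorisations correspond to cut positions. The end positions may be included, and the
  length bounds of the definition are automatic, because the empty word is not Ulam.\<close>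

lemma is_ulam_rec:
  assumes "length w > 1"
  shows "is_ulam w \<longleftrightarrow> (\<Sum>p\<le>length w. of_bool (good_cut w p)) = (1::nat)"
proof -
  have dec: "(w = u @ v \<and> u \<noteq> v \<and> (\<exists>i\<in>{1..<length w}. \<exists>j\<in>{1..<length w}. u \<in> ulam_words i \<and> v \<in> ulam_words j))
     \<longleftrightarrow> (u, v) \<in> (\<lambda>p. (take p w, drop p w)) ` {p. p \<le> length w \<and> good_cut w p}" (is "?L \<longleftrightarrow> ?R") for u v
  proof
    assume L: ?L
    then have "is_ulam u" "is_ulam v" by (auto simp: is_ulam_def)
    with L have "length u \<in> {p. p \<le> length w \<and> good_cut w p}" by (simp add: good_cut_def)
    moreover have "(u, v) = (take (length u) w, drop (length u) w)" using L by simp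
    ultimately show ?R by (rule image_eqI[rotated])
  next
    assume ?R
    then have uv: "w = u @ v" "u \<noteq> v" "is_ulam u" "is_ulam v" by (auto simp: good_cut_def)
    then have "u \<noteq> []" "v \<noteq> []" by auto
    then have len: "length u \<in> {1..<length w}" "length v \<in> {1..<length w}"
      by (simp_all add: uv(1) Suc_le_eq)
    have "\<exists>i\<in>{1..<length w}. \<exists>j\<in>{1..<length w}. u \<in> ulam_words i \<and> v \<in> ulam_words j"
      using uv(3,4)[unfolded is_ulam_iff_length]
      by (intro bexI[OF _ len(1)] bexI[OF _ len(2)] conjI)
    with uv show ?L by simp
  qed
  let ?S = "{p. p \<le> length w \<and> good_cut w p}"
  have inj: "inj_on (\<lambda>p. (take p w, drop p w)) ?S"
  proof (rule inj_onI)
    fix p q assume pq: "p \<in> ?S" "q \<in> ?S" "(take p w, drop p w) = (take q w, drop q w)"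
    then have "length (take p w) = length (take q w)" by simp
    with pq(1,2) show "p = q" by simp
  qed
  let ?T = "(\<lambda>p. (take p w, drop p w)) ` ?S"
  have "is_ulam w \<longleftrightarrow> (\<exists>!(u, v). (u, v) \<in> ?T)"
    unfolding is_ulam_iff_length dec[symmetric] ulam_words_rec[OF assms]
    by (simp only: mem_Collect_eq simp_thms)
  also have "\<dots> \<longleftrightarrow> (\<exists>!q. q \<in> ?T)" by (simp only: case_prod_eta[of "\<lambda>q. q \<in> ?T"])
  also have "\<dots> \<longleftrightarrow> card ?T = 1"
    by (simp only: card_eq_1_iff_Ex1)
  also have "\<dots> \<longleftrightarrow> card ?S = 1" by (simp add: card_image inj)
  also have "card ?S = (\<Sum>p\<le>length w. of_bool (good_cut w p))"
  proof -
    have "?S = {..length w} \<inter> {p. good_cut w p}" by auto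
    then show ?thesis by simp
  qed
  finally show ?thesis .
qed

text \<open>Separates the cuts in front of a one at position x from those behind it.\<close>

lemma sum_atMost_add_Suc:
  "(\<Sum>p\<le>x + Suc n. g p) = (\<Sum>p\<le>x. g p) + (\<Sum>i\<le>n. g (x + Suc i) :: nat)"
proof (induction n)
  case 0
  show ?case by simp
next
  case (Suc n)
  then show ?case by (simp only: add_Suc_right sum.atMost_Suc add.assoc)
qed

lemma sum_of_bool_eq_1: "(\<Sum>p\<le>(a::nat). of_bool (p = 1 \<and> Q)) = (of_bool (a > 0 \<and> Q) :: nat)"
proof -
  have "(\<Sum>p\<le>a. of_bool (p = 1 \<and> Q)) = (\<Sum>p\<le>a. if p = 1 then of_bool Q else 0 :: nat)"
    by (rule sum.cong) auto
  also have "\<dots> = of_bool (a > 0 \<and> Q)"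
    by (subst sum.delta) auto
  finally show ?thesis .
qed

lemma sum_of_bool_diff_eq_1:
  "(\<Sum>t\<le>(b::nat). of_bool (b - t = 1 \<and> P t)) = (of_bool (b > 0 \<and> P (b - 1)) :: nat)"
proof -
  have "(\<Sum>t\<le>b. of_bool (b - t = 1 \<and> P t)) =
      (\<Sum>t\<le>b. if t = b - 1 then of_bool (b > 0 \<and> P (b - 1)) else 0 :: nat)"
  proof (rule sum.cong)
    fix t assume "t \<in> {..b}"
    then have "b - t = 1 \<longleftrightarrow> b > 0 \<and> t = b - 1" by auto
    then show "of_bool (b - t = 1 \<and> P t) = (if t = b - 1 then of_bool (b > 0 \<and> P (b - 1)) else 0 :: nat)"
      by auto
  qed simp
  also have "\<dots> = of_bool (b > 0 \<and> P (b - 1))"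
    by (subst sum.delta) auto
  finally show ?thesis .
qed

section \<open>Words with at most one letter 1\<close>

lemma is_ulam_replicate_False: "is_ulam (replicate n False) \<longleftrightarrow> n = 1"
proof (induction n rule: less_induct)
  case (less n)
  consider "n = 0" | "n = 1" | "n > 1" by linarith
  then show ?case
  proof cases
    case 3
    have "\<not> good_cut (replicate n False) p" if "p \<le> n" for p
    proof
      assume c: "good_cut (replicate n False) p"
      then have u: "is_ulam (replicate p False)" "is_ulam (replicate (n - p) False)"
        "p \<noteq> n - p" using that by (auto simp: good_cut_def min_def)
      then have "p \<noteq> 0" "p \<noteq> n" by (auto intro: gr0I)
      then show False using less.IH[of p] less.IH[of "n - p"] u that by auto
    qed
    then show ?thesis using 3 by (simp add: is_ulam_rec del: sum_of_bool_eq)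
  qed simp_all
qed

lemma replicate_append_True_eq_iff:
  "replicate a False @ True # s = replicate b False @ True # t \<longleftrightarrow> a = b \<and> s = t"
proof (induction a arbitrary: b)
  case 0 then show ?case by (cases b) auto
next
  case (Suc a) then show ?case by (cases b) auto
qed

lemma replicate_ne_append_True: "replicate a False \<noteq> s @ True # t"
proof
  assume "replicate a False = s @ True # t"
  then have "True \<in> set (replicate a False)" by simp
  then show False by simp
qed

text \<open>The cut splits off a block of zeros, which is Ulam only as a single 0; the other factor
  contains a one, so the factors differ.\<close>

lemma good_cut_left:
  assumes "p \<le> a"
  shows "good_cut (replicate a False @ True # s) p
    \<longleftrightarrow> p = 1 \<and> is_ulam (replicate (a - 1) False @ True # s)"
proof -
  have "take p (replicate a False @ True # s) = replicate p False"
    "drop p (replicate a False @ True # s) = replicate (a - p) False @ True # s"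
    using assms by (simp_all add: min_def)
  then show ?thesis unfolding good_cut_def
    using replicate_ne_append_True[of p "replicate (a - p) False" s]
    by (auto simp only: is_ulam_replicate_False)
qed

lemma good_cut_right:
  assumes "t \<le> b"
  shows "good_cut (s @ True # replicate b False) (length s + Suc t)
    \<longleftrightarrow> b - t = 1 \<and> is_ulam (s @ True # replicate t False)"
proof -
  have "take (length s + Suc t) (s @ True # replicate b False) = s @ True # replicate t False"
    "drop (length s + Suc t) (s @ True # replicate b False) = replicate (b - t) False"
    using assms by (simp_all add: min_def)
  then show ?thesis unfolding good_cut_def
    using replicate_ne_append_True[of "b - t" s "replicate t False", symmetric]
    by (auto simp only: is_ulam_replicate_False)
qed

text \<open>Pascal's rule modulo 2: the binomial coefficient of a + b over a is odd exactly when a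
  and b share no one digit.\<close>

lemma and_eq_0_step:
  assumes "a > 0 \<or> (b::nat) > 0"
  shows "and a b = 0 \<longleftrightarrow>
    of_bool (a > 0 \<and> and (a - 1) b = 0) + of_bool (b > 0 \<and> and a (b - 1) = 0) = (1::nat)"
  using assms
proof (induction "a + b" arbitrary: a b rule: less_induct)
  case less
  have 1: "and (2 * m) (2 * n) = 0 \<longleftrightarrow> and m n = 0" "and (Suc (2 * m)) (2 * n) = 0 \<longleftrightarrow> and m n = 0"
    "and (2 * m) (Suc (2 * n)) = 0 \<longleftrightarrow> and m n = 0" "and (Suc (2 * m)) (Suc (2 * n)) \<noteq> 0" for m n :: nat
    using and_eq_0_double and_eq_0_double_Suc by auto
  have pred: "2 * m - 1 = Suc (2 * (m - 1))" if "m > 0" for m :: nat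
    using that by simp
  consider (ee) m n where "a = 2 * m" "b = 2 * n" | (oe) m n where "a = Suc (2 * m)" "b = 2 * n"
    | (eo) m n where "a = 2 * m" "b = Suc (2 * n)" | (oo) m n where "a = Suc (2 * m)" "b = Suc (2 * n)"
    by (metis evenE oddE Suc_eq_plus1)
  then show ?case
  proof cases
    case ee
    have "and (a - 1) b = 0 \<longleftrightarrow> and (m - 1) n = 0" if "m > 0" by (simp only: ee pred[OF that] 1)
    moreover have "and a (b - 1) = 0 \<longleftrightarrow> and m (n - 1) = 0" if "n > 0" by (simp only: ee pred[OF that] 1)
    moreover have "m + n < a + b" "m > 0 \<or> n > 0" using less.prems ee by auto
    note less.hyps[OF this]
    ultimately show ?thesis using ee 1(1)[of m n] by (simp cong: conj_cong)
  next
    case oe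
    have p: "(b > 0 \<and> and a (b - 1) = 0) \<longleftrightarrow> False"
      using pred[of n] 1(4)[of m "n - 1"] by (cases "n = 0") (simp_all add: oe)
    have q: "(a > 0 \<and> and (a - 1) b = 0) \<longleftrightarrow> and m n = 0" using 1(1)[of m n] by (simp add: oe)
    show ?thesis unfolding p q using 1(2)[of m n] by (simp add: oe)
  next
    case eo
    have p: "(a > 0 \<and> and (a - 1) b = 0) \<longleftrightarrow> False"
      using pred[of m] 1(4)[of "m - 1" n] by (cases "m = 0") (simp_all add: eo)
    have q: "(b > 0 \<and> and a (b - 1) = 0) \<longleftrightarrow> and m n = 0" using 1(1)[of m n] by (simp add: eo)
    show ?thesis unfolding p q using 1(3)[of m n] by (simp add: eo)
  next
    case oo
    have p: "(a > 0 \<and> and (a - 1) b = 0) \<longleftrightarrow> and m n = 0" using 1(3)[of m n] by (simp add: oo)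
    have q: "(b > 0 \<and> and a (b - 1) = 0) \<longleftrightarrow> and m n = 0" using 1(2)[of m n] by (simp add: oo)
    show ?thesis unfolding p q using 1(4)[of m n] by (simp add: oo)
  qed
qed

text \<open>One factor of any cut is all zeros, so a good cut detaches an outer 0; the resulting
  recursion is \<open>and_eq_0_step\<close>.\<close>

lemma is_ulam_one_one:
  "is_ulam (replicate a False @ True # replicate b False) \<longleftrightarrow> and a b = 0"
proof (induction "a + b" arbitrary: a b rule: less_induct)
  case less
  let ?w = "replicate a False @ True # replicate b False"
  show ?case
  proof (cases "a > 0 \<or> b > 0")
    case True
    have len: "length ?w = a + Suc b" by simp
    have "(\<Sum>p\<le>length ?w. of_bool (good_cut ?w p)) =
       (\<Sum>p\<le>a. of_bool (p = 1 \<and> is_ulam (replicate (a - 1) False @ True # replicate b False))) +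
       (\<Sum>t\<le>b. of_bool (b - t = 1 \<and> is_ulam (replicate a False @ True # replicate t False)) :: nat)"
      unfolding len sum_atMost_add_Suc
      using good_cut_right[of _ b "replicate a False"]
      by (intro arg_cong2[where f = "(+)"] sum.cong refl) (simp_all add: good_cut_left)
    also have "\<dots> = of_bool (a > 0 \<and> and (a - 1) b = 0) + of_bool (b > 0 \<and> and a (b - 1) = 0)"
    proof -
      have "is_ulam (replicate (a - 1) False @ True # replicate b False) \<longleftrightarrow> and (a - 1) b = 0"
        if "a > 0" using that less.hyps[of "a - 1" b] by simp
      moreover have "is_ulam (replicate a False @ True # replicate (b - 1) False) \<longleftrightarrow> and a (b - 1) = 0"
        if "b > 0" using that less.hyps[of a "b - 1"] by simp
      ultimately show ?thesis
        unfolding sum_of_bool_eq_1 sum_of_bool_diff_eq_1 by (simp cong: conj_cong)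
    qed
    finally show ?thesis using True by (subst is_ulam_rec) (auto simp: and_eq_0_step[OF True])
  qed simp
qed

section \<open>Words with two letters 1\<close>

definition ulam_at :: "nat \<Rightarrow> nat \<Rightarrow> nat \<Rightarrow> bool" where
  "ulam_at y x z \<longleftrightarrow> is_ulam (two_ones_word x y z)"

text \<open>The points where a cut between the ones yields the same Ulam word twice.\<close>

definition equal_split :: "nat \<Rightarrow> nat \<Rightarrow> nat \<Rightarrow> bool" where
  "equal_split y x z \<longleftrightarrow> x + z = y \<and> and x z = 0"

text \<open>Equal factors force \<open>i = z\<close> and \<open>x = y - z\<close>, so at most one
  summand is lost. At an equal split it is counted by \<open>splits\<close>, so the subtraction
  never truncates.\<close>

lemma splits_distinct:
  "(\<Sum>i\<le>y. of_bool (and x i = 0 \<and> and z (y - i) = 0 \<and> \<not> (x = y - i \<and> i = z))) =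
     splits x y z - of_bool (equal_split y x z)"
proof (cases "equal_split y x z")
  case True
  then have z: "z \<in> {..y}" "and x z = 0" "and z (y - z) = 0" "x = y - z"
    by (auto simp: equal_split_def and.commute)
  then have "splits x y z = 1 + (\<Sum>i\<in>{..y} - {z}. of_bool (and x i = 0 \<and> and z (y - i) = 0))"
    unfolding splits_def by (subst sum.remove[of _ z]) (auto simp del: sum_of_bool_eq)
  moreover have "(\<Sum>i\<le>y. of_bool (and x i = 0 \<and> and z (y - i) = 0 \<and> \<not> (x = y - i \<and> i = z)))
      = (\<Sum>i\<in>{..y} - {z}. of_bool (and x i = 0 \<and> and z (y - i) = 0) :: nat)"
    using z by (subst sum.remove[of _ z]) (auto simp del: sum_of_bool_eq intro!: sum.cong)
  ultimately show ?thesis using True by simp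
next
  case False
  then show ?thesis unfolding splits_def by (auto intro!: sum.cong simp: equal_split_def simp del: sum_of_bool_eq)
qed

lemma ulam_at_step:
  "ulam_at y x z \<longleftrightarrow>
     before (ulam_at y) x z + (splits x y z - of_bool (equal_split y x z)) = 1"
proof -
  let ?w = "two_ones_word x y z"
  have w: "?w = replicate x False @ True # (replicate y False @ True # replicate z False)"
     "?w = (replicate x False @ True # replicate y False) @ True # replicate z False"
    by (simp_all add: two_ones_word_def)
  have len: "length ?w = x + Suc (y + Suc z)" by (simp add: two_ones_word_def)
  have l: "good_cut ?w p \<longleftrightarrow> p = 1 \<and> ulam_at y (x - 1) z" if "p \<le> x" for p
    using good_cut_left[OF that] by (simp add: two_ones_word_def ulam_at_def)
  have r: "good_cut ?w (x + Suc (y + Suc t)) \<longleftrightarrow> z - t = 1 \<and> ulam_at y x t" if "t \<le> z" for t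
    using good_cut_right[OF that, of "replicate x False @ True # replicate y False"]
    by (simp add: two_ones_word_def ulam_at_def add.assoc)
  have m: "good_cut ?w (x + Suc i) \<longleftrightarrow>
      and x i = 0 \<and> and z (y - i) = 0 \<and> \<not> (x = y - i \<and> i = z)" if "i \<le> y" for i
    using that by (auto simp: good_cut_def two_ones_word_def is_ulam_one_one replicate_append_True_eq_iff and.commute)
  \<comment> \<open>Cuts in the left zeros, between the ones, and in the right zeros.\<close>
  have "(\<Sum>p\<le>length ?w. of_bool (good_cut ?w p)) =
      (\<Sum>p\<le>x. of_bool (p = 1 \<and> ulam_at y (x - 1) z)) +
      ((\<Sum>i\<le>y. of_bool (and x i = 0 \<and> and z (y - i) = 0 \<and> \<not> (x = y - i \<and> i = z))) +
       (\<Sum>t\<le>z. of_bool (z - t = 1 \<and> ulam_at y x t)) :: nat)"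
    unfolding len sum_atMost_add_Suc
    by (intro arg_cong2[where f = "(+)"] sum.cong refl) (simp_all only: atMost_iff l m r)
  also have "\<dots> = before (ulam_at y) x z + (splits x y z - of_bool (equal_split y x z))"
    unfolding sum_of_bool_eq_1 sum_of_bool_diff_eq_1 splits_distinct by (simp add: before_def)
  finally show ?thesis by (simp add: ulam_at_def is_ulam_rec two_ones_word_def)
qed

text \<open>The recursion refers only to smaller x + z and so determines the set. Every explicit
  description below is verified through this lemma.\<close>

lemma ulam_at_unique:
  assumes step: "\<And>x z. u x z \<longleftrightarrow> before u x z + (splits x y z - of_bool (equal_split y x z)) = 1"
  shows "ulam_at y = u"
proof -
  have "ulam_at y x z = u x z" for x z
  proof (induction "x + z" arbitrary: x z rule: less_induct)
    case less
    have "before (ulam_at y) x z = before u x z"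
    proof -
      have "ulam_at y (x - 1) z = u (x - 1) z" if "x > 0" using that less by simp
      moreover have "ulam_at y x (z - 1) = u x (z - 1)" if "z > 0" using that less by simp
      ultimately show ?thesis by (simp add: before_def cong: conj_cong)
    qed
    then show ?case by (simp add: ulam_at_step step[of x z])
  qed
  then show ?thesis by blast
qed

subsection \<open>Binary zeros and the equal-halves points\<close>

lemma and_eq_0_iff_div_2: "and x z = 0 \<longleftrightarrow> \<not> (odd x \<and> odd z) \<and> and (x div 2) (z div 2) = (0::nat)"
  by (auto simp: and_rec[of x z])

text \<open>An equal split distributes the one digits of y over x and z without carries, so last
  digits can be stripped off.\<close>

lemma equal_split_div_2:
  assumes "equal_split y x z"
  shows "equal_split (y div 2) (x div 2) (z div 2)" "odd y \<Longrightarrow> odd x \<noteq> odd z"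
    "even y \<Longrightarrow> even x \<and> even z"
proof -
  have *: "x + z = y" "\<not> (odd x \<and> odd z)" "and (x div 2) (z div 2) = 0"
    using assms and_eq_0_iff_div_2[of x z] by (auto simp: equal_split_def)
  then show "odd y \<Longrightarrow> odd x \<noteq> odd z" "even y \<Longrightarrow> even x \<and> even z" by auto
  have "x div 2 + z div 2 = y div 2" using *(1,2) by presburger
  with * show "equal_split (y div 2) (x div 2) (z div 2)" by (simp add: equal_split_def)
qed

definition zeros :: "nat \<Rightarrow> nat" where
  "zeros y = card {i. i \<le> floor_log y \<and> \<not> bit y i}"

lemma zeros_even:
  assumes "m > 0"
  shows "zeros (2 * m) = Suc (zeros m)"
proof -
  let ?S = "{i. i \<le> floor_log m \<and> \<not> bit m i}"
  have "{i. i \<le> floor_log (2 * m) \<and> \<not> bit (2 * m) i} = insert 0 (Suc ` ?S)"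
  proof (rule set_eqI)
    fix i
    show "i \<in> {i. i \<le> floor_log (2 * m) \<and> \<not> bit (2 * m) i} \<longleftrightarrow> i \<in> insert 0 (Suc ` ?S)"
      using assms by (cases i) (auto simp: floor_log_twice bit_Suc bit_0)
  qed
  moreover have "card (insert 0 (Suc ` ?S)) = Suc (card ?S)"
    by (subst card_insert_disjoint) (auto simp: card_image)
  ultimately show ?thesis by (simp add: zeros_def)
qed

lemma zeros_odd:
  assumes "m > 0"
  shows "zeros (Suc (2 * m)) = zeros m"
proof -
  let ?S = "{i. i \<le> floor_log m \<and> \<not> bit m i}"
  have fl: "floor_log (Suc (2 * m)) = Suc (floor_log m)"
    using assms floor_log_rec[of "Suc (2 * m)"] by simp
  have "{i. i \<le> floor_log (Suc (2 * m)) \<and> \<not> bit (Suc (2 * m)) i} = Suc ` ?S"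
  proof (rule set_eqI)
    fix i
    show "i \<in> {i. i \<le> floor_log (Suc (2 * m)) \<and> \<not> bit (Suc (2 * m)) i} \<longleftrightarrow> i \<in> Suc ` ?S"
      using assms by (cases i) (auto simp: fl bit_Suc bit_0)
  qed
  then show ?thesis by (simp add: zeros_def card_image)
qed

lemma zeros_1: "zeros (Suc 0) = 0"
proof -
  have "{i. i \<le> floor_log (Suc 0) \<and> \<not> bit (Suc 0) i} = {}"
    by (auto simp: bit_0 intro!: gr0I)
  then show ?thesis by (simp add: zeros_def)
qed

lemma zeros_eq_0_imp:
  assumes "m > 0" "zeros m = 0"
  shows "\<exists>s. Suc m = 2 ^ Suc s"
  using assms
proof (induction m rule: less_induct)
  case (less m)
  show ?case
  proof (cases m rule: nat_binary_cases)
    case zero with less.prems show ?thesis by simp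
  next
    case (odd k)
    show ?thesis
    proof (cases "k = 0")
      case True with odd show ?thesis by (intro exI[of _ 0]) simp
    next
      case False
      then obtain s where "Suc k = 2 ^ Suc s" using less.IH[of k] less.prems odd zeros_odd[of k] by auto
      then show ?thesis using odd by (intro exI[of _ "Suc s"]) simp
    qed
  next
    case (even k)
    then show ?thesis using less.prems zeros_even[of "Suc k"] by simp
  qed
qed

lemma half_pos: "even x \<Longrightarrow> (x::nat) > 0 \<Longrightarrow> x div 2 > 0"
  by (auto elim!: evenE)

section \<open>Counts on and near the line x + z = 2^s - 1\<close>

lemma splits_even_parities:
  assumes "odd x \<noteq> odd z"
  shows "splits x (2 * m) z = splits (x div 2) m (z div 2)"
  using assms by (cases m) (auto simp: splits_even)

lemma splits_odd_parities:
  assumes "odd x \<noteq> odd z"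
  shows "splits x (Suc (2 * m)) z = splits (x div 2) m (z div 2)"
  using assms by (auto simp: splits_odd)

lemma div_2_sum_odd:
  assumes "(x::nat) + z = Suc (2 * k)"
  shows "odd x \<noteq> odd z" "x div 2 + z div 2 = k"
  using assms by presburger+

lemma div_2_sum_even:
  assumes "(x::nat) + z = 2 * k"
  shows "odd x \<Longrightarrow> odd z \<and> Suc (x div 2 + z div 2) = k" "even x \<Longrightarrow> even z \<and> x div 2 + z div 2 = k"
  using assms by presburger+

text \<open>x and z are digitwise complementary within m. Then i lies within z and m - i within x,
  so i \<le> z and m - i \<le> x, which forces i = z.\<close>

lemma antidiagonal:
  assumes "Suc m = 2 ^ s" "x + z = m"
  shows "and x z = 0 \<and> splits x m z = 1"
  using assms
proof (induction s arbitrary: m x z)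
  case 0 then show ?case by simp
next
  case (Suc s)
  obtain k where k: "Suc k = 2 ^ s" by (metis not0_implies_Suc power_not_zero zero_neq_numeral)
  then have m: "m = Suc (2 * k)" using Suc.prems by simp
  note d = div_2_sum_odd[of x z k]
  have "and (x div 2) (z div 2) = 0 \<and> splits (x div 2) k (z div 2) = 1"
    using Suc.IH[OF k] d Suc.prems m by simp
  then show ?case using d Suc.prems m and_eq_0_iff_div_2[of x z] splits_odd_parities[of x z k] by simp
qed

text \<open>n differs from \<open>Suc n\<close> only in the last digit, so halving leads to
  \<open>antidiagonal\<close> one digit shorter.\<close>

lemma antidiagonal_pred:
  assumes "Suc (Suc n) = 2 ^ s" "x + z = Suc n"
  shows "splits x n z = 1"
proof (cases s)
  case 0 with assms show ?thesis by simp
next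
  case (Suc r)
  obtain k where k: "Suc k = 2 ^ r" by (metis not0_implies_Suc power_not_zero zero_neq_numeral)
  then have n: "n = 2 * k" using Suc assms by simp
  note d = div_2_sum_odd[of x z k]
  show ?thesis using antidiagonal[OF k, of "x div 2" "z div 2"] d assms n splits_even_parities[of x z k] by simp
qed

text \<open>For m > 0, either x + z is even and so is the count, or halving stays strictly below the
  shorter line.\<close>

lemma below_antidiagonal:
  assumes "Suc m = 2 ^ s" "x + z < m"
  shows "splits x m z \<noteq> 1"
  using assms
proof (induction s arbitrary: m x z)
  case 0 then show ?case by simp
next
  case (Suc s)
  obtain k where k: "Suc k = 2 ^ s" by (metis not0_implies_Suc power_not_zero zero_neq_numeral)
  then have m: "m = Suc (2 * k)" using Suc.prems by simp
  show ?case
  proof (cases "odd x = odd z")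
    case True
    then have "even (splits x m z)" using splits_even_if_odd[of m x z] m by simp
    then show ?thesis by auto
  next
    case False
    then have "x div 2 + z div 2 < k" using Suc.prems m by presburger
    then show ?thesis using Suc.IH[OF k] splits_odd_parities[OF False, of k] m by simp
  qed
qed

text \<open>\<open>Suc n\<close> consists of ones, so its summands are complementary: z would lie
  inside i and x outside it. But x and z share a one digit, their sum being a power of two. The
  value 1 follows by halving until x and z are odd.\<close>

lemma above_antidiagonal:
  assumes "Suc (Suc n) = 2 ^ Suc s" "x + z = Suc (Suc n)" "x > 0" "z > 0"
  shows "splits x (Suc n) z = 0 \<and> splits x n z = 1"
  using assms
proof (induction s arbitrary: n x z)
  case 0
  then have "n = 0" by simp
  then have "x = 1" "z = 1" using 0 by linarith+
  then show ?case using splits_odd[of 1 0 1] \<open>n = 0\<close> by simp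
next
  case (Suc s)
  obtain k where k: "Suc (Suc k) = 2 ^ Suc s" using Suc.prems(1)
    by (cases "2 ^ s :: nat") auto
  then have n: "n = Suc (Suc (2 * k))" using Suc.prems by simp
  have sum: "x + z = 2 * Suc (Suc k)" using Suc.prems n by simp
  note d = div_2_sum_even[OF sum]
  have s: "splits x (Suc n) z = (of_bool (even x) + of_bool (even z)) * splits (x div 2) (Suc k) (z div 2)"
     "splits x n z = splits (x div 2) (Suc k) (z div 2) + of_bool (even x \<and> even z) * splits (x div 2) k (z div 2)"
    unfolding n using splits_odd[of x "Suc k" z] by (simp_all add: splits_even)
  show ?case
  proof (cases "odd x")
    case True
    then have "splits (x div 2) (Suc k) (z div 2) = 1"
      using antidiagonal[OF k, of "x div 2" "z div 2"] d by simp
    then show ?thesis unfolding s using True d by simp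
  next
    case False
    then have e: "even x" "even z" "x div 2 + z div 2 = Suc (Suc k)" using d by auto
    moreover have "x div 2 > 0" "z div 2 > 0" using half_pos e(1,2) Suc.prems(3,4) by blast+
    ultimately show ?thesis unfolding s using Suc.IH[OF k] by simp
  qed
qed

text \<open>Both coordinates are even and m is odd, so the count is twice a positive one.\<close>

lemma above_antidiagonal_axis:
  assumes "Suc m = 2 ^ Suc s" "x + z = Suc m" "x = 0 \<or> z = 0"
  shows "splits x m z \<ge> 2"
proof -
  obtain k where m: "m = Suc (2 * k)" using assms(1)
    by (cases "2 ^ s :: nat") auto
  have "even x" "even z" using assms m by auto
  then have "splits x m z = 2 * splits (x div 2) k (z div 2)" unfolding m by (simp add: splits_odd)
  moreover have "splits (x div 2) k (z div 2) > 0"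
    using assms(3) splits_pos_left splits_pos_right by (auto simp del: neq0_conv)
  ultimately show ?thesis by simp
qed

section \<open>Counts at the equal-halves points\<close>

text \<open>Taking 1 from whichever of x and z holds the lowest one digit of \<open>Suc n\<close>
  keeps them disjoint and gives a splitting of n.\<close>

lemma splits_pred_pos:
  assumes "equal_split (Suc n) x z"
  shows "splits x n z > 0"
  using assms
proof (induction n arbitrary: x z rule: less_induct)
  case (less n)
  note h = equal_split_div_2[OF less.prems]
  show ?case
  proof (cases "Suc n" rule: nat_binary_cases)
    case zero then show ?thesis by simp
  next
    case (odd k)
    show ?thesis
    proof (cases k)
      case 0 with odd show ?thesis by simp
    next
      case (Suc j)
      have "equal_split (Suc j) (x div 2) (z div 2)" "odd x \<noteq> odd z" using h odd Suc by simp_all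
      have n: "n = 2 * Suc j" using odd Suc by simp
      have s: "splits x n z = splits (x div 2) (Suc j) (z div 2)"
        unfolding n by (rule splits_even_parities) fact
      have "splits (x div 2) (Suc j) (z div 2) > 0"
      proof -
        have e: "x div 2 + z div 2 = Suc j" "and (x div 2) (z div 2) = 0"
          using \<open>equal_split (Suc j) (x div 2) (z div 2)\<close> by (auto simp: equal_split_def)
        have "(1::nat) = of_bool (and (x div 2) (z div 2) = 0 \<and> and (z div 2) (Suc j - z div 2) = 0)"
          using e by (auto simp: and.commute simp flip: e(1))
        also have "\<dots> \<le> splits (x div 2) (Suc j) (z div 2)"
          unfolding splits_def by (rule member_le_sum) (use e in auto)
        finally show ?thesis by simp
      qed
      with s show ?thesis by simp
    qed
  next
    case (even k)
    have n: "n = Suc (2 * k)" using even by simp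
    have "equal_split (Suc k) (x div 2) (z div 2)" "even x" "even z" using h even by simp_all
    then show ?thesis using less.IH[of k] n by (simp add: splits_odd)
  qed
qed

text \<open>Appending a one digit to y keeps the count; appending a zero digit raises it by the
  positive term from \<open>splits_pred_pos\<close>.\<close>

lemma splits_gt_zeros:
  assumes "y > 0" "equal_split y x z"
  shows "splits x y z > zeros y"
  using assms
proof (induction y arbitrary: x z rule: less_induct)
  case (less y)
  note h = equal_split_div_2[OF less.prems(2)]
  show ?case
  proof (cases y rule: nat_binary_cases)
    case zero with less.prems show ?thesis by simp
  next
    case (odd k)
    have e: "equal_split k (x div 2) (z div 2)" "odd x \<noteq> odd z" using h odd by simp_all
    show ?thesis
    proof (cases "k = 0")
      case True then show ?thesis using odd e(2) splits_odd_parities[of x z 0] by (simp add: zeros_1)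
    next
      case False
      then have "splits (x div 2) k (z div 2) > zeros k" using less.IH[of k] odd e by simp
      then show ?thesis using odd e(2) False splits_odd_parities[of x z k] by (simp add: zeros_odd)
    qed
  next
    case (even k)
    have e: "equal_split (Suc k) (x div 2) (z div 2)" "even x" "even z" using h even by simp_all
    have "splits (x div 2) (Suc k) (z div 2) > zeros (Suc k)" using less.IH[of "Suc k"] even e by simp
    moreover have "splits (x div 2) k (z div 2) > 0" using splits_pred_pos[OF e(1)] .
    ultimately show ?thesis using even e zeros_even[of "Suc k"] by (simp add: splits_even)
  qed
qed

text \<open>Ones below the single zero keep the count. Above it y consists of ones, so at the zero
  \<open>antidiagonal\<close> and \<open>antidiagonal_pred\<close> contribute 1 each.\<close>

lemma splits_eq_2:
  assumes "y > 0" "zeros y = 1" "equal_split y x z"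
  shows "splits x y z = 2"
  using assms
proof (induction y arbitrary: x z rule: less_induct)
  case (less y)
  note h = equal_split_div_2[OF less.prems(3)]
  show ?case
  proof (cases y rule: nat_binary_cases)
    case zero with less.prems show ?thesis by simp
  next
    case (odd k)
    have e: "equal_split k (x div 2) (z div 2)" "odd x \<noteq> odd z" using h odd by simp_all
    have "k \<noteq> 0" using less.prems odd zeros_1 by (intro notI) simp
    then have "splits (x div 2) k (z div 2) = 2" using less.IH[of k] less.prems odd e zeros_odd[of k] by simp
    then show ?thesis using odd splits_odd_parities[OF e(2), of k] by simp
  next
    case (even k)
    have e: "equal_split (Suc k) (x div 2) (z div 2)" "even x" "even z" using h even by simp_all
    have "zeros (Suc k) = 0" using less.prems even zeros_even[of "Suc k"] by simp
    then obtain s where s: "Suc (Suc k) = 2 ^ Suc s" using zeros_eq_0_imp[of "Suc k"] by auto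
    have sum: "x div 2 + z div 2 = Suc k" using e by (simp add: equal_split_def)
    show ?thesis using antidiagonal[OF s sum] antidiagonal_pred[OF s sum] even e by (simp add: splits_even)
  qed
qed

text \<open>Needed on the line just above the equal-halves points, where neighbours must come in
  pairs. Odd x and z have the same halves on both sides; even ones are halved. For even m the count
  would be 1 by \<open>antidiagonal\<close>.\<close>

lemma and_pred_agree:
  assumes "zeros m = 1" "m > 0" "x + z = Suc m" "splits x m z = 0" "x > 0" "z > 0"
  shows "and (x - 1) z = 0 \<longleftrightarrow> and x (z - 1) = 0"
  using assms
proof (induction m arbitrary: x z rule: less_induct)
  case (less m)
  show ?case
  proof (cases m rule: nat_binary_cases)
    case zero with less.prems show ?thesis by simp
  next
    case (odd k)
    have sum: "x + z = 2 * Suc k" using less.prems odd by simp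
    note d = div_2_sum_even[OF sum]
    have dm: "(x - Suc 0) div 2 = x div 2 - of_bool (even x)" "(z - Suc 0) div 2 = z div 2 - of_bool (even z)"
      using less.prems div_2_minus_1[of x] div_2_minus_1[of z] by auto
    have k: "k > 0" using less.prems odd zeros_1 by (cases k) auto
    show ?thesis
    proof (cases "odd x")
      case True
      then show ?thesis using d less.prems
        by (simp add: and_eq_0_iff_div_2[of "x - Suc 0"] and_eq_0_iff_div_2[of x] dm)
    next
      case False
      then have e: "even x" "even z" "x div 2 + z div 2 = Suc k" using d by auto
      moreover have "x div 2 > 0" "z div 2 > 0" using half_pos e(1,2) less.prems(5,6) by blast+
      moreover have "splits (x div 2) k (z div 2) = 0" using less.prems odd e by (simp add: splits_odd)
      ultimately have "and (x div 2 - 1) (z div 2) = 0 \<longleftrightarrow> and (x div 2) (z div 2 - 1) = 0"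
        using less.IH[of k "x div 2" "z div 2"] less.prems odd k zeros_odd[OF k] by simp
      then show ?thesis using e
        by (simp add: and_eq_0_iff_div_2[of "x - Suc 0"] and_eq_0_iff_div_2[of x] dm)
    qed
  next
    case (even k)
    have "zeros (Suc k) = 0" using less.prems even zeros_even[of "Suc k"] by simp
    then obtain s where s: "Suc (Suc k) = 2 ^ Suc s" using zeros_eq_0_imp[of "Suc k"] by auto
    have "x + z = Suc (2 * Suc k)" using less.prems even by simp
    note d = div_2_sum_odd[OF this]
    have "splits x m z = 1" using splits_even_parities[OF d(1), of "Suc k"] antidiagonal[OF s d(2)] even by simp
    then show ?thesis using less.prems by simp
  qed
qed

subsection \<open>Explicit descriptions of the Ulam sets\<close>

lemma before_cong:
  assumes "x > 0 \<Longrightarrow> u (x - 1) z = v (x - 1) z" "z > 0 \<Longrightarrow> u x (z - 1) = v x (z - 1)"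
  shows "before u x z = before v x z"
  using assms by (simp add: before_def cong: conj_cong)

lemma before_eq_0:
  assumes "x > 0 \<Longrightarrow> \<not> u (x - 1) z" "z > 0 \<Longrightarrow> \<not> u x (z - 1)"
  shows "before u x z = 0"
  using assms by (auto simp: before_def)

lemma bulk_odd_sum: "bulk y x z \<Longrightarrow> odd (x + z)"
  by (simp add: bulk_def)

lemma before_bulk_odd_sum:
  assumes "odd (x + z)"
  shows "before (bulk y) x z = 0"
proof (rule before_eq_0)
  show "\<not> bulk y (x - 1) z" if "x > 0" using that assms bulk_odd_sum[of y "x - 1" z] by auto
  show "\<not> bulk y x (z - 1)" if "z > 0" using that assms bulk_odd_sum[of y x "z - 1"] by auto
qed

text \<open>\<open>bulk_step\<close> fails at the origin for y = 0. Here every count is 1 and the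
  correction acts only at the origin, so any other cell is present exactly when no neighbour
  is.\<close>

lemma ulam_at_0: "ulam_at 0 = (\<lambda>x z. odd (x + z))"
proof (rule ulam_at_unique)
  fix x z :: nat
  show "odd (x + z) \<longleftrightarrow> before (\<lambda>x z. odd (x + z)) x z + (splits x 0 z - of_bool (equal_split 0 x z)) = 1"
  proof (cases "x + z = 0")
    case True then show ?thesis by (simp add: before_def equal_split_def)
  next
    case False
    then have e: "\<not> equal_split 0 x z" by (auto simp: equal_split_def)
    show ?thesis
    proof (cases "odd (x + z)")
      case True
      have "before (\<lambda>x z. odd (x + z)) x z = 0"
        by (rule before_eq_0) (use True in auto)
      then show ?thesis using True e by simp
    next
      case ev: False
      have "before (\<lambda>x z. odd (x + z)) x z > 0"
        using False ev by (cases "x > 0") (auto simp: before_def)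
      then show ?thesis using ev e by simp
    qed
  qed
qed

text \<open>At equal-halves points the count is at least 3, so lowering it by 1 cannot produce a
  total of 1.\<close>

lemma ulam_at_not_zumkeller:
  assumes "y > 0" "zeros y \<ge> 2"
  shows "ulam_at y = bulk y"
proof (rule ulam_at_unique)
  fix x z
  show "bulk y x z \<longleftrightarrow> before (bulk y) x z + (splits x y z - of_bool (equal_split y x z)) = 1"
  proof (cases "equal_split y x z")
    case True
    then have "splits x y z \<ge> 3" using splits_gt_zeros[OF assms(1) True] assms(2) by linarith
    then show ?thesis using bulk_step[OF assms(1), of x z] True by simp
  next
    case False
    then show ?thesis using bulk_step[OF assms(1), of x z] by simp
  qed
qed

text \<open>Every point of the line x + z = y is an equal split with count 1, so the correction
  deletes this line. The next line loses its neighbours but stays empty, its counts being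
  even.\<close>

lemma ulam_at_no_zeros:
  assumes "Suc y = 2 ^ Suc r"
  shows "ulam_at y = (\<lambda>x z. bulk y x z \<and> x + z \<noteq> y)"
proof (rule ulam_at_unique)
  fix x z
  let ?u = "\<lambda>x z. bulk y x z \<and> x + z \<noteq> y"
  have y: "odd y" "y > 0" using assms by (metis even_Suc even_mult_iff even_numeral power_Suc, cases y, auto)
  consider "x + z = y" | "x + z = Suc y" | "x + z \<noteq> y" "x + z \<noteq> Suc y" by blast
  then show "?u x z \<longleftrightarrow> before ?u x z + (splits x y z - of_bool (equal_split y x z)) = 1"
  proof cases
    case 1
    have "before ?u x z = before (bulk y) x z" by (rule before_cong) (use 1 in auto)
    also have "\<dots> = 0" using before_bulk_odd_sum[of x z y] 1 y by simp
    finally show ?thesis using antidiagonal[OF assms 1] 1 by (simp add: equal_split_def)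
  next
    case 2
    have "before ?u x z = 0" by (rule before_eq_0) (use 2 in auto)
    moreover have "even (splits x y z)" using splits_even_if_odd[of y x z] 2 y by simp
    then have "splits x y z \<noteq> 1" by auto
    moreover have "\<not> ?u x z" using bulk_odd_sum[of y x z] 2 y by auto
    ultimately show ?thesis using 2 by (simp add: equal_split_def)
  next
    case 3
    have "before ?u x z = before (bulk y) x z" by (rule before_cong) (use 3 in auto)
    then show ?thesis using 3 bulk_step[OF y(2), of x z] by (simp add: equal_split_def)
  qed
qed

text \<open>At an equal split the count 2 is corrected to 1, which adds the point. On the next line
  counts are even, and where they vanish the neighbours come in pairs, so it stays empty.\<close>

lemma ulam_at_odd_one_zero:
  assumes "odd y" "zeros y = 1"
  shows "ulam_at y = (\<lambda>x z. bulk y x z \<or> equal_split y x z)"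
proof (rule ulam_at_unique)
  fix x z
  let ?u = "\<lambda>x z. bulk y x z \<or> equal_split y x z"
  have y: "y > 0" using assms(1) by (cases y) auto
  have off: "before ?u x z = before (bulk y) x z" if "x + z \<noteq> Suc y"
    by (rule before_cong) (use that in \<open>auto simp: equal_split_def\<close>)
  consider "equal_split y x z" | "x + z = Suc y" | "\<not> equal_split y x z" "x + z \<noteq> Suc y" by blast
  then show "?u x z \<longleftrightarrow> before ?u x z + (splits x y z - of_bool (equal_split y x z)) = 1"
  proof cases
    case 1
    then have s: "x + z = y" by (simp add: equal_split_def)
    then have "before ?u x z = 0" using off before_bulk_odd_sum[of x z y] assms(1) by simp
    then show ?thesis using splits_eq_2[OF y assms(2) 1] 1 by simp
  next
    case 2
    have nu: "\<not> ?u x z" using bulk_odd_sum[of y x z] 2 assms(1) by (auto simp: equal_split_def)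
    have ev: "even (splits x y z)" using splits_even_if_odd[of y x z] 2 assms(1) by simp
    have "before ?u x z + splits x y z \<noteq> 1"
    proof (cases "splits x y z = 0")
      case False
      with ev have "splits x y z \<ge> 2" by (cases "splits x y z = 1") auto
      then show ?thesis by simp
    next
      case True
      then have pos: "x > 0" "z > 0" using splits_pos_left[of y z] splits_pos_right[of x y] by (auto intro!: gr0I)
      have "equal_split y (x - 1) z \<longleftrightarrow> equal_split y x (z - 1)"
        using and_pred_agree[OF assms(2) y 2 True pos] 2 pos by (simp add: equal_split_def)
      \<comment> \<open>Exactly one bulk neighbour would give a total of 1 and put (x, z) into
        \<open>bulk y\<close>.\<close>
      moreover have "bulk y (x - 1) z \<longleftrightarrow> bulk y x (z - 1)"
        using bulk_step[OF y, of x z] nu True pos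
        by (cases "bulk y (x - 1) z"; cases "bulk y x (z - 1)") (simp_all add: before_def)
      ultimately show ?thesis using pos True by (simp add: before_def)
    qed
    then show ?thesis using nu by simp
  next
    case 3
    then show ?thesis using off bulk_step[OF y, of x z] by simp
  qed
qed

text \<open>Here y is 2^(s+2) - 2, with digits 1...10. The line x + z = y gains its even points,
  this empties the next line, and the line after that becomes full except for its two ends. Then
  \<open>bulk y\<close> takes over again.\<close>

lemma ulam_at_even_one_zero:
  assumes "Suc (Suc n) = 2 ^ Suc s" "y = 2 * Suc n"
  shows "ulam_at y = (\<lambda>x z. if x + z = y then even x else if x + z = Suc y then False
    else if x + z = Suc (Suc y) then x > 0 \<and> z > 0 else bulk y x z)" (is "_ = ?u")
proof (rule ulam_at_unique)
  fix x z
  define u where "u = ?u"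
  have u1: "u a c \<longleftrightarrow> even a" if "a + c = y" for a c using that by (simp add: u_def)
  have u2: "\<not> u a c" if "a + c = Suc y" for a c using that by (simp add: u_def)
  have u3: "u a c \<longleftrightarrow> a > 0 \<and> c > 0" if "a + c = Suc (Suc y)" for a c using that by (simp add: u_def)
  have u4: "u a c \<longleftrightarrow> bulk y a c" if "a + c < y \<or> a + c > Suc (Suc y)" for a c
    using that by (auto simp: u_def)
  have y: "y > 0" "y div 2 = Suc n" using assms(2) by simp_all
  let ?f = "splits (x div 2) (Suc n) (z div 2)"
  let ?g = "splits (x div 2) n (z div 2)"
  have s: "splits x y z = ?f + of_bool (even x \<and> even z) * ?g"
    using splits_even[of x n z] assms(2) by simp
  have b: "bulk y x z \<longleftrightarrow> odd (x + z) \<and> ?f = 1" by (simp add: bulk_def y)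
  \<comment> \<open>Halving gives coordinate sum n, one short of the line of
    \<open>antidiagonal\<close>.\<close>
  have below: "\<not> bulk y a c" if "Suc (a + c) = y" for a c
  proof -
    have "a + c = Suc (2 * n)" using that assms(2) by simp
    note div_2_sum_odd(2)[OF this]
    then show ?thesis using below_antidiagonal[OF assms(1), of "a div 2" "c div 2"] by (simp add: bulk_def y)
  qed
  consider (0) "x + z < y \<or> x + z > Suc (Suc (Suc y))" | (1) "x + z = y" | (2) "x + z = Suc y"
    | (3) "x + z = Suc (Suc y)" | (4) "x + z = Suc (Suc (Suc y))" by linarith
  then have "u x z \<longleftrightarrow> before u x z + (splits x y z - of_bool (equal_split y x z)) = 1"
  proof cases
    case 0
    have "before u x z = before (bulk y) x z"
    proof (rule before_cong)
      show "u (x - 1) z = bulk y (x - 1) z" if "x > 0" by (rule u4) (use that 0 in linarith)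
      show "u x (z - 1) = bulk y x (z - 1)" if "z > 0" by (rule u4) (use that 0 in linarith)
    qed
    moreover have "\<not> equal_split y x z" using 0 by (auto simp: equal_split_def)
    moreover have "u x z \<longleftrightarrow> bulk y x z" by (rule u4) (use 0 in linarith)
    ultimately show ?thesis using bulk_step[OF y(1), of x z] by simp
  next
    case 1
    have "before u x z = 0"
    proof (rule before_eq_0)
      show "\<not> u (x - 1) z" if "x > 0" using that 1 below[of "x - 1" z] u4[of "x - 1" z] by simp
      show "\<not> u x (z - 1)" if "z > 0" using that 1 below[of x "z - 1"] u4[of x "z - 1"] by simp
    qed
    moreover have "splits x y z - of_bool (equal_split y x z) = 1 \<longleftrightarrow> even x"
    proof (cases "even x")
      case True
      note d = div_2_sum_even(2)[OF 1[unfolded assms(2)] True]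
      have "equal_split y x z"
        using antidiagonal[OF assms(1), of "x div 2" "z div 2"] d 1 True and_eq_0_iff_div_2[of x z] by (simp add: equal_split_def)
      moreover have "splits x y z = 2"
        using antidiagonal[OF assms(1), of "x div 2" "z div 2"] antidiagonal_pred[OF assms(1), of "x div 2" "z div 2"] d True s by simp
      ultimately show ?thesis using True by simp
    next
      case False
      note d = div_2_sum_even(1)[OF 1[unfolded assms(2)] False]
      have "\<not> equal_split y x z" using d False and_eq_0_iff_div_2[of x z] by (simp add: equal_split_def)
      moreover have "splits x y z \<noteq> 1"
        using below_antidiagonal[OF assms(1), of "x div 2" "z div 2"] d False s by simp
      ultimately show ?thesis using False by simp
    qed
    ultimately show ?thesis using u1[OF 1] by simp
  next
    case 2
    then have "x + z = Suc (2 * Suc n)" using assms(2) by simp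
    note d = div_2_sum_odd[OF this]
    have f: "splits x y z = 1" using antidiagonal[OF assms(1) d(2)] d s by auto
    \<comment> \<open>The neighbour obtained by lowering the odd coordinate has both coordinates
      even, hence is present; with count 1 the total is too large.\<close>
    have "before u x z > 0"
    proof (cases "odd x")
      case True
      then have "x > 0" by (rule odd_pos)
      with True have "u (x - 1) z" using 2 u1[of "x - 1" z] by simp
      with \<open>x > 0\<close> show ?thesis by (simp add: before_def)
    next
      case False
      then have "z > 0" using d(1) by (intro odd_pos) simp
      with False have "u x (z - 1)" using 2 u1[of x "z - 1"] by simp
      with \<open>z > 0\<close> show ?thesis by (simp add: before_def)
    qed
    then show ?thesis using f 2 u2[OF 2] by (simp add: equal_split_def)
  next
    case 3
    have "before u x z = 0"
    proof (rule before_eq_0)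
      show "\<not> u (x - 1) z" if "x > 0" by (rule u2) (use that 3 in linarith)
      show "\<not> u x (z - 1)" if "z > 0" by (rule u2) (use that 3 in linarith)
    qed
    moreover have "splits x y z = 1 \<longleftrightarrow> x > 0 \<and> z > 0"
    proof -
      have sum: "x + z = 2 * Suc (Suc n)" using 3 assms(2) by simp
      show ?thesis
      proof (cases "even x")
        case False
        note d = div_2_sum_even(1)[OF sum False]
        have "x > 0" "z > 0" using False d odd_pos by blast+
        then show ?thesis
          using antidiagonal[OF assms(1), of "x div 2" "z div 2"] d s False by simp
      next
        case True
        note d = div_2_sum_even(2)[OF sum True]
        show ?thesis
        proof (cases "x > 0 \<and> z > 0")
          case pos: True
          then have "x div 2 > 0" "z div 2 > 0" using half_pos True d by blast+
          then show ?thesis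
            using above_antidiagonal[OF assms(1), of "x div 2" "z div 2"] d s True pos by simp
        next
          case False
          then have "x div 2 = 0 \<or> z div 2 = 0" by auto
          then have "?f \<ge> 2" using above_antidiagonal_axis[OF assms(1), of "x div 2" "z div 2"] d by simp
          then show ?thesis using s False by simp
        qed
      qed
    qed
    ultimately show ?thesis using 3 u3[OF 3] by (simp add: equal_split_def)
  next
    case 4
    then have "x + z = Suc (2 * Suc (Suc n))" using assms(2) by simp
    note d = div_2_sum_odd[OF this]
    have f: "splits x y z = ?f" using d s by auto
    \<comment> \<open>Away from the axes the halved count is 0 and both neighbours lie on the full
      line; otherwise the halved count is at least 2.\<close>
    have "before u x z + splits x y z \<noteq> 1 \<and> ?f \<noteq> 1"
    proof (cases "x div 2 > 0 \<and> z div 2 > 0")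
      case True
      then have xz: "x \<ge> 2" "z \<ge> 2" by (simp_all add: div_greater_zero_iff)
      then have "u (x - 1) z" "u x (z - 1)" using 4 u3[of "x - 1" z] u3[of x "z - 1"] by simp_all
      then have "before u x z = 2" unfolding before_def using xz by simp
      then show ?thesis
        using above_antidiagonal[OF assms(1), of "x div 2" "z div 2"] d True by simp
    next
      case False
      then have "x div 2 = 0 \<or> z div 2 = 0" using neq0_conv by blast
      then have "?f \<ge> 2" by (rule above_antidiagonal_axis[OF assms(1) d(2)])
      then show ?thesis using f by simp
    qed
    moreover have "u x z \<longleftrightarrow> bulk y x z" by (rule u4) (use 4 in linarith)
    ultimately show ?thesis using 4 b by (simp add: equal_split_def)
  qed
  then show "?u x z \<longleftrightarrow> before ?u x z + (splits x y z - of_bool (equal_split y x z)) = 1"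
    unfolding u_def .
qed

section \<open>Comparison with the biperiodic part\<close>

lemma zumkeller_iff_zeros: "zumkeller y \<longleftrightarrow> y > 0 \<and> zeros y \<le> 1"
  by (simp add: zumkeller_def zeros_def)

text \<open>The explicit descriptions depart from \<open>bulk y\<close> only on lines close to x + z
  = y, which barely leave the block.\<close>

lemma ulam_at_zumkeller_outside:
  assumes "zumkeller y" and outside: "\<not> (x < 2 ^ (floor_log y + 1) \<and> z < 2 ^ (floor_log y + 1))"
  shows "ulam_at y x z = bulk y x z"
proof -
  let ?q = "2 ^ (floor_log y + 1) :: nat"
  have y: "y > 0" "zeros y \<le> 1" using assms by (simp_all add: zumkeller_iff_zeros)
  have q: "y < ?q" using floor_log_exp2_gt[of y] by simp
  have sum: "x + z \<ge> ?q" using outside by auto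
  consider (none) "zeros y = 0" | (odd) "zeros y = 1" "odd y" | (even) "zeros y = 1" "even y"
    using y(2) by linarith
  then show ?thesis
  proof cases
    case none
    then obtain r where "Suc y = 2 ^ Suc r" using zeros_eq_0_imp[OF y(1)] by blast
    then show ?thesis using ulam_at_no_zeros sum q by simp
  next
    case odd
    then show ?thesis using ulam_at_odd_one_zero sum q by (simp add: equal_split_def)
  next
    case even
    obtain n where n: "y = 2 * Suc n" using even(2) y(1) by (cases y rule: nat_binary_cases) auto
    then have "zeros (Suc n) = 0" using zeros_even[of "Suc n"] even by simp
    then obtain s where s: "Suc (Suc n) = 2 ^ Suc s" using zeros_eq_0_imp[of "Suc n"] by auto
    \<comment> \<open>Since y + 2 \<le> \<open>?q\<close>, a point of the line x + z = y + 2 outside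
      the block has a zero coordinate; such ends are absent from both sets.\<close>
    have "even ?q" by simp
    then have "Suc y < ?q" using q even by presburger
    moreover have "\<not> bulk y x z" "x = 0 \<or> z = 0" if "x + z = Suc (Suc y)"
      using that outside \<open>Suc y < ?q\<close> even(2) bulk_odd_sum[of y x z] by auto
    ultimately show ?thesis using ulam_at_even_one_zero[OF s n] sum by auto
  qed
qed

lemma periodic_part_eq:
  assumes "zumkeller y"
  shows "periodic_part y = {(x, z). bulk y x z}"
proof -
  let ?q = "2 ^ (floor_log y + 1) :: nat"
  let ?agree = "\<lambda>P. \<forall>x z. \<not> (x < ?q \<and> z < ?q) \<longrightarrow> ((x, z) \<in> P \<longleftrightarrow> (x, z) \<in> Ulam_set y)"
  have y: "y < ?q" using floor_log_exp2_gt[of y] by simp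
  have "(THE P. biperiodic ?q P \<and> ?agree P) = {(x, z). bulk y x z}"
  proof (rule the_equality)
    show "biperiodic ?q {(x, z). bulk y x z} \<and> ?agree {(x, z). bulk y x z}"
      using bulk_add_period[OF y] ulam_at_zumkeller_outside[OF assms]
      by (simp add: biperiodic_def Ulam_set_def ulam_at_def)
  next
    fix P assume P: "biperiodic ?q P \<and> ?agree P"
    have "(x, z) \<in> P \<longleftrightarrow> bulk y x z" for x z
    proof -
      \<comment> \<open>One shift by the period leaves the block, where P is prescribed.\<close>
      have "(x, z) \<in> P \<longleftrightarrow> (x + ?q, z) \<in> P" using P unfolding biperiodic_def by blast
      also have "\<dots> \<longleftrightarrow> (x + ?q, z) \<in> Ulam_set y" using P by simp
      also have "\<dots> \<longleftrightarrow> bulk y (x + ?q) z"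
        using ulam_at_zumkeller_outside[OF assms, of "x + ?q" z] by (simp add: Ulam_set_def ulam_at_def)
      also have "\<dots> \<longleftrightarrow> bulk y x z" using bulk_add_period(1)[OF y] by simp
      finally show ?thesis .
    qed
    then show "P = {(x, z). bulk y x z}" by auto
  qed
  then show ?thesis unfolding periodic_part_def Let_def .
qed

lemma Ulam_set_not_impurity:
  assumes "y > 0" "(x, z) \<notin> impurities y"
  shows "(x, z) \<in> Ulam_set y \<longleftrightarrow> bulk y x z"
proof (cases "zumkeller y")
  case True
  then show ?thesis using assms(2) periodic_part_eq[OF True] by (auto simp: impurities_def)
next
  case False
  then show ?thesis using assms(1) ulam_at_not_zumkeller[of y]
    by (simp add: zumkeller_iff_zeros Ulam_set_def flip: ulam_at_def)
qed

theorem theorem1p8: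
  fixes y :: nat
  assumes "odd y"
  shows "(\<not> zumkeller y \<longrightarrow> Ulam_set y = Ulam_set (y - 1)) \<and>
         (zumkeller y \<longrightarrow>
            (\<forall>x z. (x, z) \<notin> impurities y \<and> (x, z) \<notin> impurities (y - 1) \<longrightarrow>
               ((x, z) \<in> Ulam_set y \<longleftrightarrow> (x, z) \<in> Ulam_set (y - 1))))"
proof -
  obtain m where y: "y = Suc (2 * m)" using assms by (metis oddE Suc_eq_plus1)
  have agree: "(x, z) \<in> Ulam_set y \<longleftrightarrow> (x, z) \<in> Ulam_set (y - 1)"
    if "(x, z) \<notin> impurities y" "(x, z) \<notin> impurities (y - 1)" for x z
  proof -
    have "(x, z) \<in> Ulam_set y \<longleftrightarrow> bulk y x z" using Ulam_set_not_impurity that(1) y by simp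
    \<comment> \<open>\<open>bulk\<close> sees y only through \<open>y div 2\<close>, which is m for
      both numbers.\<close>
    also have "\<dots> \<longleftrightarrow> bulk (y - 1) x z" by (simp add: bulk_def y)
    also have "\<dots> \<longleftrightarrow> (x, z) \<in> Ulam_set (y - 1)"
    \<comment> \<open>For m = 0 the second set is that of 0, where \<open>ulam_at_0\<close> replaces
      the bulk description.\<close>
    proof (cases "m = 0")
      case True
      have "(x, z) \<in> Ulam_set 0 \<longleftrightarrow> odd (x + z)"
        using ulam_at_0 by (simp add: Ulam_set_def flip: ulam_at_def)
      then show ?thesis using True y by (simp add: bulk_def)
    next
      case False
      then show ?thesis using Ulam_set_not_impurity[OF _ that(2)] y by simp
    qed
    finally show ?thesis .
  qed
  \<comment> \<open>\<open>y - 1\<close> has one zero digit more than y, so it is not a Zumkeller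
    number either.\<close>
  have "impurities y = {} \<and> impurities (y - 1) = {}" if "\<not> zumkeller y"
  proof -
    have "m > 0" using that y zeros_1 by (cases m) (auto simp: zumkeller_iff_zeros)
    then have "\<not> zumkeller (y - 1)" using that y zeros_odd zeros_even by (simp add: zumkeller_iff_zeros)
    with that show ?thesis by (simp add: impurities_def)
  qed
  with agree show ?thesis by auto
qed

end
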